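(* Let $A$ be a non-cyclic abelian group of order $n=2^f n_1$, where $f\ge 0$ and $n_1$ is odd. If every skew morphism of $A$ is smooth, then $n_1$ is square-free and the Sylow $2$-subgroup of $A$ contains no direct factor isomorphic to $\mathbb{Z}_{2^e}$ for any $e\ge 5$.
   Context: All groups are finite. A skew morphism of a group $A$ is a permutation $\varphi$ of $A$ fixing the identity element of $A$ and for which there exists a function $\pi:A\to\mathbb{Z}$ (the power function associated with $\varphi$) such that $\varphi(ab)=\varphi(a)\varphi^{\pi(a)}(b)$ for all $a,b\in A$. The values of $\pi$ are uniquely determined modulo $|\varphi|$, where $|\varphi|$ is the order of the permutation $\varphi$. The skew morphism $\varphi$ is smooth if $\pi(\varphi(a))\equiv\pi(a)\pmod{|\varphi|}$ for all $a\in A$. *)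

theory Defs
  imports
    "HOL-Algebra.Algebra"
    "HOL-Number_Theory.Cong"
    "HOL-Computational_Algebra.Squarefree"
begin

text \<open>
  Permutations of a group are elements of \<^const>\<open>Bij\<close>, i.e. bijections of the carrier that are
  \<^const>\<open>undefined\<close> outside it. Integer powers and the order of a permutation are those of
  the symmetric group \<^const>\<open>BijGroup\<close>, whose product is composition of functions.
\<close>

definition power_function ::
    "('a, 'b) monoid_scheme \<Rightarrow> ('a \<Rightarrow> 'a) \<Rightarrow> ('a \<Rightarrow> int) \<Rightarrow> bool" where
  "power_function A \<phi> \<pi> \<longleftrightarrow>
     (\<forall>a\<in>carrier A. \<forall>b\<in>carrier A.
        \<phi> (a \<otimes>\<^bsub>A\<^esub> b) = \<phi> a \<otimes>\<^bsub>A\<^esub> (\<phi> [^]\<^bsub>BijGroup (carrier A)\<^esub> \<pi> a) b)"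

definition skew_morphism :: "('a, 'b) monoid_scheme \<Rightarrow> ('a \<Rightarrow> 'a) \<Rightarrow> bool" where
  "skew_morphism A \<phi> \<longleftrightarrow>
     \<phi> \<in> Bij (carrier A) \<and> \<phi> \<one>\<^bsub>A\<^esub> = \<one>\<^bsub>A\<^esub> \<and> (\<exists>\<pi>. power_function A \<phi> \<pi>)"

text \<open>
  A power function is determined on the carrier only modulo the order of the skew morphism
  (lemma \<open>power_function_unique\<close> below), so the congruence does not depend on the choice of \<open>\<pi>\<close>.
\<close>

definition smooth_skew_morphism :: "('a, 'b) monoid_scheme \<Rightarrow> ('a \<Rightarrow> 'a) \<Rightarrow> bool" where
  "smooth_skew_morphism A \<phi> \<longleftrightarrow>
     skew_morphism A \<phi> \<and>
     (\<forall>\<pi>. power_function A \<phi> \<pi> \<longrightarrow>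
        (\<forall>a\<in>carrier A. [\<pi> (\<phi> a) = \<pi> a] (mod int (group.ord (BijGroup (carrier A)) \<phi>))))"

lemma power_function_unique:
  assumes "group A" "\<phi> \<in> Bij (carrier A)"
    and "power_function A \<phi> \<pi>" "power_function A \<phi> \<pi>'" and a: "a \<in> carrier A"
  shows "[\<pi> a = \<pi>' a] (mod int (group.ord (BijGroup (carrier A)) \<phi>))"
proof -
  interpret A: group A by fact
  interpret S: group "BijGroup (carrier A)" by (rule group_BijGroup)
  have carr: "carrier (BijGroup (carrier A)) = Bij (carrier A)"
    by (simp add: BijGroup_def)
  have \<phi>: "\<phi> \<in> carrier (BijGroup (carrier A))"
    unfolding carr by fact
  have pow: "\<phi> [^]\<^bsub>BijGroup (carrier A)\<^esub> k \<in> Bij (carrier A)" for k :: int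
    using S.int_pow_closed[OF \<phi>, of k] unfolding carr .
  have mem: "(\<phi> [^]\<^bsub>BijGroup (carrier A)\<^esub> k) b \<in> carrier A" if "b \<in> carrier A" for b and k :: int
    using Bij_imp_funcset[OF pow[of k]] that by (rule funcset_mem)
  have \<phi>a: "\<phi> a \<in> carrier A"
    using Bij_imp_funcset[OF assms(2)] a by (rule funcset_mem)
  have "\<phi> [^]\<^bsub>BijGroup (carrier A)\<^esub> \<pi> a = \<phi> [^]\<^bsub>BijGroup (carrier A)\<^esub> \<pi>' a"
  proof (rule extensionalityI[where A = "carrier A"])
    fix b assume b: "b \<in> carrier A"
    have "\<phi> a \<otimes>\<^bsub>A\<^esub> (\<phi> [^]\<^bsub>BijGroup (carrier A)\<^esub> \<pi> a) b =
          \<phi> a \<otimes>\<^bsub>A\<^esub> (\<phi> [^]\<^bsub>BijGroup (carrier A)\<^esub> \<pi>' a) b"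
      using assms(3,4)[unfolded power_function_def, rule_format, OF a b] by simp
    then show "(\<phi> [^]\<^bsub>BijGroup (carrier A)\<^esub> \<pi> a) b = (\<phi> [^]\<^bsub>BijGroup (carrier A)\<^esub> \<pi>' a) b"
      by (rule A.l_cancel[OF _ mem[OF b] mem[OF b] \<phi>a])
  qed (rule Bij_imp_extensional[OF pow])+
  then show ?thesis
    using S.int_pow_eq[OF \<phi>] by (metis cong_iff_dvd_diff cong_sym)
qed

definition sylow_subgroup :: "nat \<Rightarrow> ('a, 'b) monoid_scheme \<Rightarrow> 'a set \<Rightarrow> bool" where
  "sylow_subgroup p G P \<longleftrightarrow> subgroup P G \<and> card P = p ^ multiplicity p (order G)"

definition direct_factor :: "'a set \<Rightarrow> ('a, 'b) monoid_scheme \<Rightarrow> bool" where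
  "direct_factor H G \<longleftrightarrow>
     H \<lhd> G \<and> (\<exists>K. K \<lhd> G \<and> H \<inter> K = {\<one>\<^bsub>G\<^esub>} \<and> H <#>\<^bsub>G\<^esub> K = carrier G)"

end

theory Submission
  imports Defs
begin

text \<open>
  Let \<open>t\<close> be an element of order \<open>m\<close> of an abelian group, \<open>\<chi>\<close> a homomorphism to the integers modulo
  \<open>2 m\<close> with \<open>\<chi>(t) = 0\<close>, and put \<open>\<phi>(a) = a\<^sup>-\<^sup>1 t^T(\<chi>(a))\<close> with \<open>T(k) = k (k + 1) / 2\<close>. From
  \<open>T(k + l) = T(k) + T(l) + k l\<close> and \<open>T(-k) = T(k) - k\<close> one gets \<open>\<phi>(a b) = \<phi>(a) \<phi>(b) t^(\<chi>(a) \<chi>(b))\<close>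
  and \<open>\<phi>(\<phi>(b)) = b t^(-\<chi>(b))\<close>, so \<open>\<phi>\<close> is a skew morphism with power function \<open>1 + 2 \<chi>\<close>. Since
  \<open>\<chi>(\<phi>(a)) = -\<chi>(a)\<close>, smoothness would give \<open>\<phi>^(4 \<chi>(a)) = 1\<close>, hence \<open>m\<close> divides \<open>2 \<chi>(a)\<^sup>2\<close> for all \<open>a\<close>.
  This fails in two cases. If \<open>p\<^sup>2\<close> divides the order for an odd prime \<open>p\<close>, take a subgroup of index
  \<open>p\<close>, an element \<open>t\<close> of order \<open>p\<close> in it, and \<open>\<chi>\<close> twice the quotient map. If \<open>g\<close> generates a direct
  factor of order \<open>2^e\<close> of the Sylow \<open>2\<close>-subgroup with \<open>e \<ge> 5\<close>, take \<open>t = g^(2^(e - 2))\<close> of order \<open>4\<close>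
  and for \<open>\<chi>(a)\<close> the exponent of \<open>g\<close> in \<open>a^n\<^sub>1\<close> modulo \<open>8\<close>; here \<open>e \<ge> 5\<close> ensures \<open>\<chi>(t) = 0\<close>.
\<close>

section \<open>Triangular numbers and their residues\<close>

definition triangle :: "int \<Rightarrow> int" where
  "triangle k = k * (k + 1) div 2"

lemma two_triangle: "2 * triangle k = k * (k + 1)"
  by (simp add: triangle_def)

lemma triangle_add: "triangle (k + l) = triangle k + triangle l + k * l"
proof -
  have "2 * triangle (k + l) = 2 * (triangle k + triangle l + k * l)"
    by (simp only: distrib_left two_triangle) (simp add: algebra_simps)
  then show ?thesis by simp
qed

lemma triangle_uminus: "triangle (- k) = triangle k - k"
proof -
  have "2 * triangle (- k) = 2 * (triangle k - k)"
    by (simp only: right_diff_distrib two_triangle) (simp add: algebra_simps)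
  then show ?thesis by simp
qed

text \<open>Halving costs a factor of two in the modulus: the triangular number of
  \<open>2 * m * d\<close> is \<open>m * d * (2 * m * d + 1)\<close>, and the cross term with
  \<open>l\<close> is also a multiple of \<open>m\<close>. So for \<open>t\<close> of order
  \<open>m\<close> the power \<open>t [^] triangle (\<chi> a)\<close> is well defined once
  \<open>\<chi> a\<close> is known modulo \<open>2 * m\<close>.\<close>

lemma triangle_cong:
  assumes "[k = l] (mod 2 * m)"
  shows "[triangle k = triangle l] (mod m)"
proof -
  obtain d where d: "k = l + 2 * m * d"
    using assms by (metis cong_iff_lin cong_sym)
  have "2 * triangle (2 * m * d) = 2 * (m * (d * (2 * m * d + 1)))"
    by (simp only: two_triangle mult.assoc)
  then have "triangle (2 * m * d) = m * (d * (2 * m * d + 1))"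
    by simp
  then have "triangle k - triangle l = m * (d * (2 * m * d + 1) + 2 * l * d)"
    unfolding d triangle_add by (simp add: algebra_simps)
  then show ?thesis
    by (simp add: cong_iff_dvd_diff)
qed

section \<open>The quadratic twist, its powers and its power function\<close>

locale quadratic_twist = comm_group G for G (structure) +
  fixes t :: 'a and \<chi> :: "'a \<Rightarrow> int"
  assumes t_closed [simp]: "t \<in> carrier G"
    and \<chi>_mult: "\<And>a b. a \<in> carrier G \<Longrightarrow> b \<in> carrier G \<Longrightarrow>
      [\<chi> (a \<otimes> b) = \<chi> a + \<chi> b] (mod 2 * int (ord t))"
    and \<chi>_t: "[\<chi> t = 0] (mod 2 * int (ord t))"
begin

definition twist :: "'a \<Rightarrow> 'a" where
  "twist = (\<lambda>a\<in>carrier G. inv a \<otimes> t [^] triangle (\<chi> a))"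

text \<open>The square of \<open>twist\<close> is \<open>shear (- 1)\<close>, and composition adds
  the indices, so this family gives all even powers of \<open>twist\<close> in closed form.\<close>

definition shear :: "int \<Rightarrow> 'a \<Rightarrow> 'a" where
  "shear i = (\<lambda>a\<in>carrier G. a \<otimes> t [^] (i * \<chi> a))"

lemma twist_closed [simp]: "a \<in> carrier G \<Longrightarrow> twist a \<in> carrier G"
  by (simp add: twist_def)

lemma shear_closed [simp]: "a \<in> carrier G \<Longrightarrow> shear i a \<in> carrier G"
  by (simp add: shear_def)

lemma t_pow_cong: "[k = l] (mod int (ord t)) \<Longrightarrow> t [^] k = t [^] l"
  using int_pow_eq[OF t_closed] by (metis cong_iff_dvd_diff cong_sym)

lemma \<chi>_one: "[\<chi> \<one> = 0] (mod 2 * int (ord t))"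
  using \<chi>_mult[of \<one> \<one>] by (simp add: cong_iff_dvd_diff)

lemma \<chi>_inv:
  assumes "a \<in> carrier G"
  shows "[\<chi> (inv a) = - \<chi> a] (mod 2 * int (ord t))"
proof -
  have "[\<chi> a + \<chi> (inv a) = \<chi> \<one>] (mod 2 * int (ord t))"
    using \<chi>_mult[of a "inv a"] assms by (simp add: cong_sym)
  then have "[\<chi> a + \<chi> (inv a) = 0] (mod 2 * int (ord t))"
    using \<chi>_one cong_trans by blast
  then show ?thesis
    by (simp add: cong_iff_dvd_diff add.commute)
qed

lemma \<chi>_t_nat_pow: "[\<chi> (t [^] (n::nat)) = 0] (mod 2 * int (ord t))"
proof (induction n)
  case 0
  then show ?case using \<chi>_one by simp
next
  case (Suc n)
  then show ?case
    using cong_trans[OF \<chi>_mult[of "t [^] n" t] cong_add[OF Suc \<chi>_t]] by simp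
qed

lemma \<chi>_t_pow: "[\<chi> (t [^] (k::int)) = 0] (mod 2 * int (ord t))"
proof (cases k rule: int_cases2)
  case (nonneg n)
  then show ?thesis using \<chi>_t_nat_pow[of n] by (simp add: int_pow_int)
next
  case (nonpos n)
  have "[- \<chi> (t [^] n) = - 0] (mod 2 * int (ord t))"
    using \<chi>_t_nat_pow[of n] by (simp only: cong_minus_minus_iff)
  then show ?thesis
    using \<chi>_inv[of "t [^] n"] nonpos by (auto simp: int_pow_neg int_pow_int intro: cong_trans)
qed

lemma \<chi>_mult_t_pow:
  assumes "a \<in> carrier G"
  shows "[\<chi> (a \<otimes> t [^] (k::int)) = \<chi> a] (mod 2 * int (ord t))"
  using cong_trans[OF \<chi>_mult[of a "t [^] k"] cong_add[OF cong_refl \<chi>_t_pow]] assms by simp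

lemma \<chi>_twist:
  assumes "a \<in> carrier G"
  shows "[\<chi> (twist a) = - \<chi> a] (mod 2 * int (ord t))"
  using cong_trans[OF \<chi>_mult_t_pow \<chi>_inv] assms by (simp add: twist_def)

lemma cong_ord: "[k = l] (mod 2 * int (ord t)) \<Longrightarrow> [k = l] (mod int (ord t))"
  using cong_modulus_mult by (metis mult.commute)

text \<open>Multiplication by a power of \<open>t\<close> does not change \<open>\<chi>\<close>
  modulo \<open>2 * ord t\<close>, so the triangular exponent keeps its effect and only the
  inversion in \<open>twist\<close> acts on the extra factor.\<close>

lemma twist_mult_t_pow:
  assumes "a \<in> carrier G"
  shows "twist (a \<otimes> t [^] (k::int)) = twist a \<otimes> t [^] (- k)"
proof -
  have "t [^] triangle (\<chi> (a \<otimes> t [^] k)) = t [^] triangle (\<chi> a)"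
    by (intro t_pow_cong triangle_cong \<chi>_mult_t_pow assms)
  then show ?thesis
    using assms by (simp add: twist_def inv_mult int_pow_neg m_ac)
qed

text \<open>The inner factor \<open>t [^] triangle (\<chi> a)\<close> comes out inverted, while
  \<open>inv a\<close> contributes the exponent \<open>triangle (\<chi> a) - \<chi> a\<close>. The
  triangular numbers cancel and the linear term remains.\<close>

lemma twist_twist:
  assumes "a \<in> carrier G"
  shows "twist (twist a) = shear (- 1) a"
proof -
  have "t [^] triangle (\<chi> (inv a)) = t [^] (triangle (\<chi> a) - \<chi> a)"
    using t_pow_cong[OF triangle_cong[OF \<chi>_inv[OF assms]]] by (simp add: triangle_uminus)
  moreover have "twist (twist a) = twist (inv a) \<otimes> t [^] (- triangle (\<chi> a))"
    using twist_mult_t_pow[of "inv a"] assms by (simp add: twist_def)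
  ultimately show ?thesis
    using assms by (simp add: twist_def shear_def m_assoc flip: int_pow_mult)
qed

text \<open>A shear moves each element within its coset of the powers of \<open>t\<close>, where
  \<open>\<chi>\<close> is constant modulo \<open>2 * ord t\<close>; hence the exponents
  add.\<close>

lemma shear_shear:
  assumes "a \<in> carrier G"
  shows "shear i (shear j a) = shear (i + j) a"
proof -
  have "t [^] (i * \<chi> (a \<otimes> t [^] (j * \<chi> a))) = t [^] (i * \<chi> a)"
    by (intro t_pow_cong cong_ord cong_scalar_left \<chi>_mult_t_pow assms)
  then show ?thesis
    using assms by (simp add: shear_def m_assoc distrib_right add.commute flip: int_pow_mult)
qed

lemma shear_0: "shear 0 = (\<lambda>a\<in>carrier G. a)"
  by (auto simp: shear_def)

lemma shear_Bij: "shear i \<in> Bij (carrier G)"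
proof -
  have "bij_betw (shear i) (carrier G) (carrier G)"
    by (rule bij_betw_byWitness[where f' = "shear (- i)"]) (auto simp: shear_shear shear_0)
  then show ?thesis
    by (simp add: Bij_def shear_def)
qed

text \<open>The square of \<open>twist\<close> is inverted on both sides by \<open>shear 1\<close>:
  the left inverse yields injectivity, the right inverse surjectivity.\<close>

lemma twist_Bij: "twist \<in> Bij (carrier G)"
proof -
  have "inj_on twist (carrier G)"
  proof (rule inj_on_inverseI)
    fix a assume "a \<in> carrier G"
    then show "shear 1 (twist (twist a)) = a"
      by (simp add: twist_twist shear_shear shear_0)
  qed
  moreover have "twist (twist (shear 1 a)) = a" if "a \<in> carrier G" for a
    using that by (simp add: twist_twist shear_shear shear_0)
  then have "twist ` carrier G = carrier G"
    by (metis image_subsetI shear_closed subsetI subset_antisym rev_image_eqI twist_closed)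
  ultimately have "bij_betw twist (carrier G) (carrier G)"
    by (simp add: bij_betw_def)
  then show ?thesis
    by (simp add: Bij_def twist_def)
qed

abbreviation Sym :: "('a \<Rightarrow> 'a) monoid" where
  "Sym \<equiv> BijGroup (carrier G)"

lemma Sym_mult_apply:
  "f \<in> Bij (carrier G) \<Longrightarrow> g \<in> Bij (carrier G) \<Longrightarrow> a \<in> carrier G \<Longrightarrow> (f \<otimes>\<^bsub>Sym\<^esub> g) a = f (g a)"
  by (simp add: BijGroup_def compose_def)

lemma Sym_mult_eqI:
  assumes "f \<in> Bij (carrier G)" "g \<in> Bij (carrier G)" "h \<in> Bij (carrier G)"
    and "\<And>a. a \<in> carrier G \<Longrightarrow> f (g a) = h a"
  shows "f \<otimes>\<^bsub>Sym\<^esub> g = h"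
proof (rule extensionalityI[where A = "carrier G"])
  show "f \<otimes>\<^bsub>Sym\<^esub> g \<in> extensional (carrier G)"
    using assms(1,2) by (simp add: BijGroup_def)
qed (use assms in \<open>auto simp: Sym_mult_apply Bij_def\<close>)

lemma shear_pow: "shear 1 [^]\<^bsub>Sym\<^esub> (i::int) = shear i"
proof -
  interpret S: group Sym by (rule group_BijGroup)
  have carr: "shear j \<in> carrier Sym" for j
    using shear_Bij by (simp add: BijGroup_def)
  have add: "shear i \<otimes>\<^bsub>Sym\<^esub> shear j = shear (i + j)" for i j
    by (rule Sym_mult_eqI) (simp_all add: shear_Bij shear_shear)
  have one: "shear 0 = \<one>\<^bsub>Sym\<^esub>"
    by (simp add: shear_0 BijGroup_def)
  have nat: "shear 1 [^]\<^bsub>Sym\<^esub> n = shear (int n)" for n :: nat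
    by (induction n) (simp_all add: one add add.commute)
  show ?thesis
  proof (cases i rule: int_cases2)
    case (nonneg n)
    then show ?thesis by (simp add: int_pow_int nat)
  next
    case (nonpos n)
    have "inv\<^bsub>Sym\<^esub> shear (int n) = shear (- int n)"
      by (rule S.inv_equality) (simp_all add: add one carr)
    then show ?thesis
      using nonpos carr by (simp add: S.int_pow_neg int_pow_int nat)
  qed
qed

lemma twist_pow_even: "twist [^]\<^bsub>Sym\<^esub> (2 * i) = shear (- i)" for i :: int
proof -
  interpret S: group Sym by (rule group_BijGroup)
  have carr: "twist \<in> carrier Sym" "shear 1 \<in> carrier Sym"
    using twist_Bij shear_Bij by (simp_all add: BijGroup_def)
  have "twist [^]\<^bsub>Sym\<^esub> (2::int) = twist \<otimes>\<^bsub>Sym\<^esub> twist"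
    using S.int_pow_mult[OF carr(1), of 1 1] carr by simp
  also have "\<dots> = shear (- 1)"
    by (rule Sym_mult_eqI) (simp_all add: twist_Bij shear_Bij twist_twist)
  \<comment> \<open>Both sides are now powers in the symmetric group, so raising them to the power
    \<open>i\<close> only multiplies exponents.\<close>
  also have "\<dots> = shear 1 [^]\<^bsub>Sym\<^esub> (- 1 :: int)"
    by (simp add: shear_pow)
  finally show ?thesis
    using S.int_pow_pow[OF carr(1), of 2 i] S.int_pow_pow[OF carr(2), of "- 1" i]
    by (simp add: shear_pow)
qed

text \<open>One factor \<open>twist\<close> is split off from an even power. Applied last, it
  inverts the power of \<open>t\<close> produced by \<open>shear (- i)\<close>, which restores the
  positive sign.\<close>

lemma twist_pow_odd:
  fixes i :: int
  assumes "a \<in> carrier G"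
  shows "(twist [^]\<^bsub>Sym\<^esub> (1 + 2 * i)) a = twist a \<otimes> t [^] (i * \<chi> a)"
proof -
  interpret S: group Sym by (rule group_BijGroup)
  have carr: "twist \<in> carrier Sym"
    using twist_Bij by (simp add: BijGroup_def)
  have "twist [^]\<^bsub>Sym\<^esub> (1 + 2 * i) = twist \<otimes>\<^bsub>Sym\<^esub> shear (- i)"
    using S.int_pow_mult[OF carr, of 1 "2 * i"] carr by (simp add: twist_pow_even)
  then show ?thesis
    using assms twist_mult_t_pow[OF assms, of "- i * \<chi> a"]
    by (simp add: Sym_mult_apply twist_Bij shear_Bij) (simp add: shear_def)
qed

text \<open>The cross term of \<open>triangle_add\<close> is the whole deviation of
  \<open>twist\<close> from a homomorphism. By \<open>twist_pow_odd\<close>, the bracket is the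
  value at \<open>b\<close> of the power \<open>1 + 2 * \<chi> a\<close> of
  \<open>twist\<close>.\<close>

lemma twist_mult:
  assumes "a \<in> carrier G" "b \<in> carrier G"
  shows "twist (a \<otimes> b) = twist a \<otimes> (twist b \<otimes> t [^] (\<chi> a * \<chi> b))"
proof -
  have "t [^] triangle (\<chi> (a \<otimes> b)) = t [^] (triangle (\<chi> a) + triangle (\<chi> b) + \<chi> a * \<chi> b)"
    using t_pow_cong[OF triangle_cong[OF \<chi>_mult[OF assms]]] by (simp add: triangle_add)
  then show ?thesis
    using assms by (simp add: twist_def inv_mult int_pow_mult m_ac)
qed

lemma twist_power_function: "power_function G twist (\<lambda>a. 1 + 2 * \<chi> a)"
  by (simp add: power_function_def twist_pow_odd twist_mult)

lemma twist_one: "twist \<one> = \<one>"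
proof -
  have "t [^] triangle (\<chi> \<one>) = t [^] triangle 0"
    by (intro t_pow_cong triangle_cong \<chi>_one)
  then show ?thesis
    by (simp add: twist_def triangle_def)
qed

lemma skew_morphism_twist: "skew_morphism G twist"
  using twist_Bij twist_one twist_power_function by (auto simp: skew_morphism_def)

text \<open>Smoothness at \<open>a\<close> makes an even power of \<open>twist\<close> trivial, that
  is, a certain \<open>shear i\<close>. Evaluating this shear at \<open>a\<close> itself brings in a
  second factor \<open>\<chi> a\<close>.\<close>

lemma smooth_twistD:
  assumes "smooth_skew_morphism G twist" and a: "a \<in> carrier G"
  shows "int (ord t) dvd 2 * (\<chi> a)\<^sup>2"
proof -
  interpret S: group Sym by (rule group_BijGroup)
  have carr: "twist \<in> carrier Sym"
    using twist_Bij by (simp add: BijGroup_def)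
  define i where "i = \<chi> a - \<chi> (twist a)"
  have "[1 + 2 * \<chi> (twist a) = 1 + 2 * \<chi> a] (mod int (S.ord twist))"
    using assms twist_power_function by (auto simp: smooth_skew_morphism_def)
  then have "int (S.ord twist) dvd 2 * (- i)"
    by (simp add: i_def cong_iff_dvd_diff right_diff_distrib)
  then have "twist [^]\<^bsub>Sym\<^esub> (2 * (- i)) = \<one>\<^bsub>Sym\<^esub>"
    using S.int_pow_eq_id[OF carr] by blast
  then have "shear i = \<one>\<^bsub>Sym\<^esub>"
    unfolding twist_pow_even by simp
  then have "shear i a = a"
    using a by (simp add: BijGroup_def)
  then have "t [^] (i * \<chi> a) = \<one>"
    using a by (simp add: shear_def)
  then have "int (ord t) dvd i * \<chi> a"
    using int_pow_eq_id[OF t_closed] by blast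
  \<comment> \<open>Here \<open>i\<close> is congruent to \<open>2 * \<chi> a\<close>, because
    \<open>twist\<close> negates \<open>\<chi>\<close>.\<close>
  moreover have "[i * \<chi> a = (\<chi> a - (- \<chi> a)) * \<chi> a] (mod int (ord t))"
    unfolding i_def by (intro cong_ord cong_scalar_right cong_diff cong_refl \<chi>_twist a)
  ultimately show ?thesis
    by (simp add: cong_dvd_iff power2_eq_square algebra_simps)
qed

end

section \<open>Elements of odd prime order and homomorphisms to the integers modulo a prime\<close>

lemma (in group) exists_element_of_prime_order:
  assumes "finite (carrier G)" "Factorial_Ring.prime p" "p dvd order G"
  obtains x where "x \<in> carrier G" "ord x = p"
proof -
  \<comment> \<open>Sylow's theorem with exponent 1, where \<open>m\<close> may still be divisible
    by \<open>p\<close>, gives a subgroup of order \<open>p\<close> and hence Cauchy's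
    theorem.\<close>
  obtain m where "order G = p ^ 1 * m"
    using assms(3) by auto
  then obtain H where H: "subgroup H G" "card H = p"
    using sylow_thm[OF assms(2) is_group _ assms(1), of 1] by auto
  interpret H: group "G\<lparr>carrier := H\<rparr>"
    using H(1) by (rule subgroup.subgroup_is_group) (rule is_group)
  have "\<not> H \<subseteq> {\<one>}"
    using H(2) prime_gt_1_nat[OF assms(2)] card_mono[of "{\<one>}" H] by auto
  then obtain x where x: "x \<in> H" "x \<noteq> \<one>"
    by blast
  have xG: "x \<in> carrier G"
    using x(1) H(1) subgroup.mem_carrier by metis
  have "x [^] p = \<one>"
    using H.pow_order_eq_1[of x] x(1) H(2) by (simp add: order_def flip: nat_pow_consistent)
  then have "ord x dvd p"
    using pow_eq_id xG by blast
  then have "ord x = p"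
    using assms(2) x(2) xG ord_eq_1 by (auto simp: prime_nat_iff)
  with xG show thesis by (rule that)
qed

text \<open>Take \<open>B\<close> maximal among the proper subgroups containing all
  \<open>p\<close>-th powers. By maximality any \<open>c\<close> outside \<open>B\<close> generates
  the group together with \<open>B\<close>, and \<open>c [^] p\<close> lies in \<open>B\<close>, so
  the quotient is cyclic of order \<open>p\<close>. The last two properties express this through
  exponents of \<open>c\<close>, without forming the quotient.\<close>

lemma (in comm_group) exists_prime_index_subgroup:
  assumes fin: "finite (carrier G)" and p: "Factorial_Ring.prime p" and p_dvd: "p dvd order G"
  obtains B c where "subgroup B G" "c \<in> carrier G"
    "\<And>i::int. c [^] i \<in> B \<longleftrightarrow> int p dvd i"
    "\<And>a. a \<in> carrier G \<Longrightarrow> \<exists>i::int. a \<otimes> c [^] (- i) \<in> B"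
proof -
  define Pw where "Pw = (\<lambda>a. a [^] p) ` carrier G"
  define S where "S = {B. subgroup B G \<and> Pw \<subseteq> B \<and> B \<noteq> carrier G}"
  have "group_hom G G (\<lambda>a. a [^] p)"
    by unfold_locales (auto simp: hom_def nat_pow_distrib)
  then have "subgroup Pw G"
    unfolding Pw_def by (rule group_hom.img_is_subgroup)
  \<comment> \<open>On a finite group a surjective \<open>p\<close>-th power map would be injective,
    but it kills an element of order \<open>p\<close>.\<close>
  moreover have "Pw \<noteq> carrier G"
  proof
    assume "Pw = carrier G"
    then have inj: "inj_on (\<lambda>a. a [^] p) (carrier G)"
      using fin by (simp add: Pw_def eq_card_imp_inj_on)
    obtain x where "x \<in> carrier G" "ord x = p"
      using exists_element_of_prime_order fin p p_dvd by blast
    moreover from this have "x [^] p = \<one> [^] p"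
      using pow_ord_eq_1[of x] by simp
    ultimately have "x = \<one>"
      using inj by (metis inj_onD one_closed)
    then show False
      using \<open>ord x = p\<close> p ord_eq_1[of x] by auto
  qed
  ultimately have "Pw \<in> S"
    by (simp add: S_def)
  moreover have "finite S"
    by (rule finite_subset[of _ "Pow (carrier G)"]) (auto simp: S_def fin dest: subgroup.subset)
  ultimately obtain B where "B \<in> S" and max: "\<And>C. C \<in> S \<Longrightarrow> B \<subseteq> C \<Longrightarrow> C = B"
    using finite_has_maximal[of S] by blast
  then have B: "subgroup B G" "Pw \<subseteq> B" "B \<noteq> carrier G"
    by (auto simp: S_def)
  interpret B: subgroup B G by (rule B(1))
  obtain c where c: "c \<in> carrier G" "c \<notin> B"
    using B(3) B.subset by blast
  define C where "C = range (\<lambda>n::int. c [^] n)"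
  have C: "subgroup C G"
    unfolding C_def by (rule subgroup_of_powers[OF c(1)])
  have BC_I: "b \<otimes> d \<in> B <#> C" if "b \<in> B" "d \<in> C" for b d
    using that by (auto simp: set_mult_def)
  have BC: "B <#> C = carrier G"
  proof (rule ccontr)
    assume neq: "B <#> C \<noteq> carrier G"
    have "b \<in> B <#> C" if "b \<in> B" for b
      using BC_I[OF that subgroup.one_closed[OF C]] that by simp
    then have sub: "B \<subseteq> B <#> C" by blast
    then have "B <#> C = B"
      using max mult_subgroups[OF B(1) C] B(2) neq by (auto simp: S_def)
    moreover have "c [^] (1::int) \<in> C"
      unfolding C_def by blast
    then have "\<one> \<otimes> c \<in> B <#> C"
      using BC_I[OF B.one_closed, of c] c(1) by simp
    ultimately show False
      using c by simp
  qed
  have pow_B: "x [^] (i::int) \<in> B" if "x \<in> B" for x i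
    using subgroup_int_pow_closed[OF B(1) that] .
  have c_pow: "c [^] i \<in> B \<longleftrightarrow> int p dvd i" for i :: int
  proof
    assume "int p dvd i"
    then obtain k where "i = k * int p" by (metis dvdE mult.commute)
    then have "c [^] i = (c [^] k) [^] p"
      using int_pow_pow[OF c(1), of k "int p"] by (simp add: int_pow_int)
    then show "c [^] i \<in> B"
      using B(2) c(1) by (auto simp: Pw_def)
  next
    assume i: "c [^] i \<in> B"
    show "int p dvd i"
    proof (rule ccontr)
      assume "\<not> int p dvd i"
      \<comment> \<open>By Bezout, \<open>c\<close> would be a product of powers of
        \<open>c [^] i\<close> and \<open>c [^] p\<close>, both in \<open>B\<close>.\<close>
      then have "coprime i (int p)"
        using p prime_imp_coprime[of "int p" i] by (simp add: coprime_commute)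
      then obtain u v where uv: "u * i + v * int p = 1"
        using bezout_int[of i "int p"] by auto
      have "c [^] p \<in> B"
        using B(2) c(1) by (auto simp: Pw_def)
      then have "(c [^] i) [^] u \<otimes> (c [^] int p) [^] v \<in> B"
        using i pow_B by (simp add: int_pow_int)
      moreover have "(c [^] i) [^] u \<otimes> (c [^] int p) [^] v = c [^] (u * i + v * int p)"
        using c(1) by (simp add: int_pow_pow int_pow_mult mult.commute)
      ultimately show False
        using c uv by simp
    qed
  qed
  have "\<exists>i::int. a \<otimes> c [^] (- i) \<in> B" if "a \<in> carrier G" for a
  proof -
    have "a \<in> B <#> C"
      using that BC by simp
    then obtain b d where b: "b \<in> B" "d \<in> C" "a = b \<otimes> d"
      by (auto simp: set_mult_def)
    then obtain i :: int where i: "d = c [^] i"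
      by (auto simp: C_def)
    have "b \<in> carrier G"
      using b(1) by simp
    then have "a \<otimes> c [^] (- i) = b"
      using c(1) by (simp add: b(3) i m_assoc flip: int_pow_mult)
    then have "a \<otimes> c [^] (- i) \<in> B"
      using b(1) by simp
    then show ?thesis ..
  qed
  with B(1) c(1) c_pow show thesis
    by (rule that)
qed

text \<open>The value \<open>\<chi> a\<close> is an exponent of \<open>c\<close> representing the
  coset of \<open>a\<close> modulo \<open>B\<close>, unique modulo \<open>p\<close>. Since
  \<open>B\<close> has index \<open>p\<close>, its order is still divisible by \<open>p\<close>, so
  \<open>t\<close> can be found inside \<open>B\<close>, where \<open>\<chi>\<close>
  vanishes.\<close>

lemma (in comm_group) hom_mod_prime:
  assumes fin: "finite (carrier G)" and p: "Factorial_Ring.prime p" and dvd: "p\<^sup>2 dvd order G"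
  obtains t c \<chi> where "t \<in> carrier G" "ord t = p" "c \<in> carrier G"
    "\<And>a b. a \<in> carrier G \<Longrightarrow> b \<in> carrier G \<Longrightarrow> [\<chi> (a \<otimes> b) = \<chi> a + \<chi> b] (mod int p)"
    "[\<chi> t = 0] (mod int p)" "[\<chi> c = 1] (mod int p)"
proof -
  have p_dvd: "p dvd order G"
    using dvd by (auto simp: power2_eq_square elim: dvd_mult_left)
  obtain B c where B: "subgroup B G" and c: "c \<in> carrier G"
    and c_pow: "\<And>i::int. c [^] i \<in> B \<longleftrightarrow> int p dvd i"
    and cover: "\<And>a. a \<in> carrier G \<Longrightarrow> \<exists>i::int. a \<otimes> c [^] (- i) \<in> B"
    using exists_prime_index_subgroup[OF fin p p_dvd] by blast
  interpret B: subgroup B G by (rule B)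
  from cover obtain \<chi> :: "'a \<Rightarrow> int" where \<chi>: "\<And>a. a \<in> carrier G \<Longrightarrow> a \<otimes> c [^] (- \<chi> a) \<in> B"
    by metis
  have unique: "[i = \<chi> a] (mod int p)" if "a \<in> carrier G" "a \<otimes> c [^] (- i) \<in> B" for a i
  proof -
    have "inv (a \<otimes> c [^] (- i)) \<otimes> (a \<otimes> c [^] (- \<chi> a)) \<in> B"
      using that(2) \<chi>[OF that(1)] by blast
    also have "inv (a \<otimes> c [^] (- i)) \<otimes> (a \<otimes> c [^] (- \<chi> a)) = c [^] i \<otimes> c [^] (- \<chi> a)"
    proof -
      have "inv a \<otimes> (a \<otimes> c [^] (- \<chi> a)) = c [^] (- \<chi> a)"
        using that(1) c by (simp flip: m_assoc)
      then show ?thesis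
        using that(1) c by (simp add: inv_mult_group m_assoc int_pow_neg)
    qed
    also have "\<dots> = c [^] (i - \<chi> a)"
      using c int_pow_mult[of c i "- \<chi> a"] by simp
    finally show ?thesis
      by (simp add: c_pow cong_iff_dvd_diff)
  qed
  have hom: "[\<chi> (a \<otimes> b) = \<chi> a + \<chi> b] (mod int p)" if "a \<in> carrier G" "b \<in> carrier G" for a b
  proof -
    have "(a \<otimes> c [^] (- \<chi> a)) \<otimes> (b \<otimes> c [^] (- \<chi> b)) \<in> B"
      using \<chi> that by blast
    also have "(a \<otimes> c [^] (- \<chi> a)) \<otimes> (b \<otimes> c [^] (- \<chi> b)) =
        (a \<otimes> b) \<otimes> c [^] (- \<chi> a + (- \<chi> b))"
      using that c by (simp only: int_pow_mult) (simp add: m_ac)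
    finally show ?thesis
      using unique[of "a \<otimes> b" "\<chi> a + \<chi> b"] that by (simp add: cong_sym)
  qed
  have \<chi>_B: "[\<chi> b = 0] (mod int p)" if "b \<in> B" for b
    using unique[of b 0] that by (simp add: cong_sym)
  have cancel: "b \<otimes> c [^] i \<otimes> c [^] (- i) = b" if "b \<in> carrier G" for b and i :: int
    using that c by (simp add: m_assoc flip: int_pow_mult)
  \<comment> \<open>This bijection counts the group as \<open>card B * p\<close>, so one factor
    \<open>p\<close> of the order is left for \<open>B\<close>.\<close>
  have "bij_betw (\<lambda>(b, i). b \<otimes> c [^] i) (B \<times> {0..<int p}) (carrier G)"
  proof (rule bij_betw_imageI)
    show "inj_on (\<lambda>(b, i). b \<otimes> c [^] i) (B \<times> {0..<int p})"
    proof (clarify intro!: inj_onI)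
      fix b b' and i j :: int
      assume b: "b \<in> B" "b' \<in> B" and ij: "i \<in> {0..<int p}" "j \<in> {0..<int p}"
        and eq: "b \<otimes> c [^] i = b' \<otimes> c [^] j"
      have "b \<otimes> c [^] i \<otimes> c [^] (- i) = b" "b \<otimes> c [^] i \<otimes> c [^] (- j) = b'"
        using cancel[of b i] cancel[of b' j] eq b by simp_all
      then have "[i = \<chi> (b \<otimes> c [^] i)] (mod int p)" "[j = \<chi> (b \<otimes> c [^] i)] (mod int p)"
        using b c by (auto intro!: unique)
      then have "[i = j] (mod int p)"
        by (metis cong_sym cong_trans)
      then have "i = j"
        using ij by (simp add: cong_def)
      then show "b = b' \<and> i = j"
        using eq b c by simp
    qed
    show "(\<lambda>(b, i). b \<otimes> c [^] i) ` (B \<times> {0..<int p}) = carrier G"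
    proof (intro subset_antisym subsetI)
      fix a assume a: "a \<in> carrier G"
      define i where "i = \<chi> a mod int p"
      have "int p dvd \<chi> a - i"
        by (simp add: i_def)
      then have "a \<otimes> c [^] (- \<chi> a) \<otimes> c [^] (\<chi> a - i) \<in> B"
        using \<chi>[OF a] c_pow by blast
      then have "a \<otimes> c [^] (- i) \<in> B"
        using a c by (simp add: m_assoc flip: int_pow_mult)
      moreover have "a = a \<otimes> c [^] (- i) \<otimes> c [^] i"
        using a c by (simp add: m_assoc flip: int_pow_mult)
      moreover have "i \<in> {0..<int p}"
        using p by (simp add: i_def prime_gt_0_nat)
      ultimately show "a \<in> (\<lambda>(b, i). b \<otimes> c [^] i) ` (B \<times> {0..<int p})"
        by force
    qed (use c in auto)
  qed
  then have "order G = card B * p"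
    by (simp add: order_def card_cartesian_product flip: bij_betw_same_card)
  then have "p dvd card B"
    using dvd p by (simp add: power2_eq_square prime_gt_0_nat)
  moreover interpret GB: group "G\<lparr>carrier := B\<rparr>"
    by (rule B.subgroup_is_group[OF is_group])
  have "finite B"
    using fin B.subset by (rule rev_finite_subset)
  ultimately obtain t where t: "t \<in> B" "GB.ord t = p"
    using GB.exists_element_of_prime_order[OF _ p] by (auto simp: order_def)
  have tG: "t \<in> carrier G"
    using t(1) by simp
  have "t [^] n = \<one> \<longleftrightarrow> p dvd n" for n :: nat
    using GB.pow_eq_id[of t n] t by (simp flip: nat_pow_consistent)
  then have "ord t = p"
    using pow_eq_id[OF tG] by (metis dvd_antisym dvd_refl)
  moreover have "[\<chi> c = 1] (mod int p)"
    using unique[of c 1] c by (simp add: int_pow_neg cong_sym)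
  ultimately show thesis
    using that[OF tG _ c hom \<chi>_B[OF t(1)]] by blast
qed

lemma (in comm_group) prime_square_not_dvd_order:
  assumes "finite (carrier G)" "Factorial_Ring.prime p" "odd p"
    and "\<forall>\<phi>. skew_morphism G \<phi> \<longrightarrow> smooth_skew_morphism G \<phi>"
  shows "\<not> p\<^sup>2 dvd order G"
proof
  assume "p\<^sup>2 dvd order G"
  then obtain t c \<chi> where t: "t \<in> carrier G" "ord t = p" and c: "c \<in> carrier G"
    and hom: "\<And>a b. a \<in> carrier G \<Longrightarrow> b \<in> carrier G \<Longrightarrow> [\<chi> (a \<otimes> b) = \<chi> a + \<chi> b] (mod int p)"
    and \<chi>: "[\<chi> t = 0] (mod int p)" "[\<chi> c = 1] (mod int p)"
    using hom_mod_prime[OF assms(1,2)] by metis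
  \<comment> \<open>Doubling turns congruences modulo \<open>p\<close> into the congruences modulo
    \<open>2 * p\<close> that the locale demands.\<close>
  interpret quadratic_twist G t "\<lambda>a. 2 * \<chi> a"
  proof
    show "[2 * \<chi> (a \<otimes> b) = 2 * \<chi> a + 2 * \<chi> b] (mod 2 * int (ord t))"
      if "a \<in> carrier G" "b \<in> carrier G" for a b
      using cong_cmult_leftI[OF hom[OF that], of 2] t(2) by (simp add: distrib_left)
    show "[2 * \<chi> t = 0] (mod 2 * int (ord t))"
      using cong_cmult_leftI[OF \<chi>(1), of 2] t(2) by simp
  qed (rule t(1))
  \<comment> \<open>At \<open>c\<close>, where \<open>\<chi>\<close> is 1 modulo \<open>p\<close>,
    the smoothness condition says that \<open>p\<close> divides 8.\<close>
  have "int p dvd 2 * (2 * \<chi> c)\<^sup>2"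
    using smooth_twistD[OF _ c] skew_morphism_twist assms(4) t(2) by auto
  moreover have "[2 * (2 * \<chi> c)\<^sup>2 = 2 * (2 * 1)\<^sup>2] (mod int p)"
    by (intro cong_mult cong_pow cong_refl \<chi>(2))
  ultimately have "int p dvd 2 ^ 3"
    by (simp add: cong_dvd_iff)
  then have "int p dvd 2"
    using assms(2) prime_dvd_power[of "int p" 2 3] by simp
  then have "p dvd 2"
    by (metis int_dvd_int_iff of_nat_numeral)
  then show False
    using assms(3) prime_ge_2_nat[OF assms(2)] dvd_imp_le[of p 2] by (cases "p = 2") auto
qed

section \<open>Cyclic factors of order divisible by 32\<close>

lemma (in comm_group) discrete_log_of_factor:
  assumes H: "subgroup H G" and K: "subgroup K G" and HK: "H \<inter> K = {\<one>}"
    and r: "r \<in> iso (G\<lparr>carrier := H\<rparr>) (integer_mod_group N)"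
    and pow: "\<And>a. a \<in> carrier G \<Longrightarrow> a [^] (n::nat) \<in> H <#> K"
  obtains \<chi> where
    "\<And>a b. a \<in> carrier G \<Longrightarrow> b \<in> carrier G \<Longrightarrow> [\<chi> (a \<otimes> b) = \<chi> a + \<chi> b] (mod int N)"
    "\<And>h. h \<in> H \<Longrightarrow> \<chi> h = r (h [^] n)"
proof -
  interpret H: subgroup H G by fact
  interpret K: subgroup K G by fact
  \<comment> \<open>The \<open>H\<close>-component \<open>u a\<close> of \<open>a [^] n\<close> is
    unique because \<open>H\<close> and \<open>K\<close> meet trivially. So \<open>u\<close> is
    multiplicative, and \<open>r\<close> composed with \<open>u\<close> serves as
    \<open>\<chi>\<close> on the whole group.\<close>
  have "\<exists>u\<in>H. \<exists>k\<in>K. a [^] n = u \<otimes> k" if "a \<in> carrier G" for a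
    using pow[OF that] by (auto simp: set_mult_def)
  then obtain u k where uk: "\<And>a. a \<in> carrier G \<Longrightarrow> u a \<in> H \<and> k a \<in> K \<and> a [^] n = u a \<otimes> k a"
    by metis
  have unique: "v = u a" if "a \<in> carrier G" "v \<in> H" "l \<in> K" "a [^] n = v \<otimes> l" for a v l
  proof -
    have mem: "u a \<in> H" "k a \<in> K"
      using uk[OF that(1)] by auto
    have carr: "v \<in> carrier G" "l \<in> carrier G" "u a \<in> carrier G" "k a \<in> carrier G"
      using mem that by auto
    have eq: "v \<otimes> l = u a \<otimes> k a"
      using uk that by metis
    have "inv (u a) \<otimes> v = inv (u a) \<otimes> (v \<otimes> l) \<otimes> inv l"
      using carr by (simp add: m_assoc)
    also have "\<dots> = k a \<otimes> inv l"
      unfolding eq using carr by (simp flip: m_assoc)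
    finally have "inv (u a) \<otimes> v \<in> H \<inter> K"
      using mem that by (metis H.m_closed H.m_inv_closed IntI K.m_closed K.m_inv_closed)
    then have "inv (u a) \<otimes> v = \<one>"
      using HK by blast
    then show ?thesis
      using carr by (metis inv_closed inv_equality inv_inv)
  qed
  show thesis
  proof (rule that)
    fix a b assume ab: "a \<in> carrier G" "b \<in> carrier G"
    have "u a \<otimes> u b = u (a \<otimes> b)"
    proof (rule unique)
      show "(a \<otimes> b) [^] n = u a \<otimes> u b \<otimes> (k a \<otimes> k b)"
        using ab uk[OF ab(1)] uk[OF ab(2)] by (simp add: nat_pow_distrib m_ac)
    qed (use ab uk in auto)
    moreover have "r (u a \<otimes> u b) = (r (u a) + r (u b)) mod int N"
      using r uk ab by (auto simp: iso_def hom_def)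
    ultimately show "[r (u (a \<otimes> b)) = r (u a) + r (u b)] (mod int N)"
      by (simp add: cong_def)
  next
    fix h assume h: "h \<in> H"
    then have "h [^] n \<in> H"
      using subgroup_int_pow_closed[OF H, of h "int n"] by (simp add: int_pow_int)
    then show "r (u h) = r (h [^] n)"
      using unique[of h "h [^] n" \<one>] h by simp
  qed
qed

text \<open>If \<open>g\<close> corresponds to 1 under the isomorphism, then
  \<open>g [^] (8 * q)\<close> has order 4, and its \<open>\<chi>\<close>-value
  \<open>8 * q * n\<close> vanishes modulo 8, twice that order. Smoothness at \<open>g\<close> would
  make \<open>\<chi> g\<close> even, whereas it is congruent to the odd number
  \<open>n\<close>.\<close>

lemma (in comm_group) no_cyclic_factor_of_order_multiple_of_32:
  assumes H: "subgroup H G" and K: "subgroup K G" and HK: "H \<inter> K = {\<one>}"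
    and iso: "G\<lparr>carrier := H\<rparr> \<cong> integer_mod_group (32 * q)" and "q > 0"
    and pow: "\<And>a. a \<in> carrier G \<Longrightarrow> a [^] (n::nat) \<in> H <#> K" and "odd n"
    and smooth: "\<forall>\<phi>. skew_morphism G \<phi> \<longrightarrow> smooth_skew_morphism G \<phi>"
  shows False
proof -
  interpret H: subgroup H G by fact
  interpret GH: group "G\<lparr>carrier := H\<rparr>"
    by (rule H.subgroup_is_group[OF is_group])
  obtain r where r: "r \<in> iso (G\<lparr>carrier := H\<rparr>) (integer_mod_group (32 * q))"
    using iso by (auto simp: is_iso_def)
  obtain \<chi> where hom: "\<And>a b. a \<in> carrier G \<Longrightarrow> b \<in> carrier G \<Longrightarrow>
      [\<chi> (a \<otimes> b) = \<chi> a + \<chi> b] (mod int (32 * q))"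
    and \<chi>_H: "\<And>h. h \<in> H \<Longrightarrow> \<chi> h = r (h [^] n)"
    using discrete_log_of_factor[OF H K HK r pow] by metis
  interpret r: group_hom "G\<lparr>carrier := H\<rparr>" "integer_mod_group (32 * q)" r
    using r by (simp add: group_hom_def group_hom_axioms_def iso_def)
  have bij: "bij_betw r H {0..<int (32 * q)}"
    using r \<open>q > 0\<close> by (simp add: iso_def carrier_integer_mod_group)
  moreover have "1 \<in> {0..<int (32 * q)}"
    using \<open>q > 0\<close> by simp
  ultimately obtain g where g: "g \<in> H" "r g = 1"
    by (metis bij_betw_imp_surj_on imageE)
  have gG: "g \<in> carrier G"
    using g(1) by simp
  have g_pow_H: "g [^] k \<in> H" for k :: nat
    using subgroup_int_pow_closed[OF H g(1), of "int k"] by (simp add: int_pow_int)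
  have r_pow: "r (g [^] k) = int k mod int (32 * q)" for k :: nat
    using r.hom_nat_pow[of g k] g by (simp flip: nat_pow_consistent)
  have g_pow: "g [^] k = \<one> \<longleftrightarrow> 32 * q dvd k" for k :: nat
  proof -
    have "g [^] k = \<one> \<longleftrightarrow> r (g [^] k) = r \<one>"
      using bij g_pow_H by (auto simp: bij_betw_def inj_on_eq_iff)
    also have "\<dots> \<longleftrightarrow> int (32 * q) dvd int k"
      using r.hom_one by (simp add: r_pow dvd_eq_mod_eq_0)
    finally show ?thesis
      by (simp only: int_dvd_int_iff)
  qed
  define t where "t = g [^] (8 * q)"
  have t: "t \<in> carrier G"
    using gG by (simp add: t_def)
  have "t [^] k = \<one> \<longleftrightarrow> 4 dvd k" for k :: nat
  proof -
    have "32 * q dvd 8 * q * k \<longleftrightarrow> (8 * q) * 4 dvd (8 * q) * k"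
      by (simp add: mult.commute)
    then show ?thesis
      using \<open>q > 0\<close> by (simp add: t_def nat_pow_pow gG g_pow)
  qed
  then have ord_t: "ord t = 4"
    using pow_eq_id[OF t] by (metis dvd_antisym dvd_refl)
  have \<chi>_g_pow: "[\<chi> (g [^] k) = int (k * n)] (mod 8)" for k :: nat
  proof -
    have "[\<chi> (g [^] k) = int (k * n)] (mod int (32 * q))"
      by (simp only: \<chi>_H[OF g_pow_H] nat_pow_pow[OF gG] r_pow cong_mod_left cong_refl)
    then show ?thesis
      by (rule cong_dvd_modulus) simp
  qed
  interpret quadratic_twist G t \<chi>
  proof
    show "[\<chi> (a \<otimes> b) = \<chi> a + \<chi> b] (mod 2 * int (ord t))"
      if "a \<in> carrier G" "b \<in> carrier G" for a b
      using hom[OF that] by (rule cong_dvd_modulus) (simp add: ord_t)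
    have "[\<chi> t = int (8 * q * n)] (mod 8)"
      unfolding t_def by (rule \<chi>_g_pow)
    then show "[\<chi> t = 0] (mod 2 * int (ord t))"
      by (simp add: ord_t cong_def)
  qed (rule t)
  have "4 dvd 2 * (\<chi> g)\<^sup>2"
    using smooth_twistD[OF _ gG] skew_morphism_twist smooth ord_t by auto
  moreover have "even y" if "4 dvd 2 * y" for y :: int
    using that by presburger
  ultimately have "even (\<chi> g)"
    using even_power by blast
  moreover have "[\<chi> g = int n] (mod 8)"
    using \<chi>_g_pow[of 1] gG by simp
  then have "[\<chi> g = int n] (mod 2)"
    by (rule cong_dvd_modulus) simp
  then have "even (\<chi> g) \<longleftrightarrow> even (int n)"
    by (rule cong_dvd_iff)
  ultimately show False
    using \<open>odd n\<close> by simp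
qed

section \<open>The odd part of the order and the Sylow 2-subgroup\<close>

theorem theorem1p2:
  fixes A :: "('a, 'b) monoid_scheme" and f n\<^sub>1 :: nat
  assumes "comm_group A"
    and "finite (carrier A)"
    and "\<not> cyclic_group A"
    and "order A = 2 ^ f * n\<^sub>1"
    and "odd n\<^sub>1"
    and "\<forall>\<phi>. skew_morphism A \<phi> \<longrightarrow> smooth_skew_morphism A \<phi>"
  shows "squarefree n\<^sub>1 \<and>
    (\<forall>P. sylow_subgroup 2 A P \<longrightarrow>
      (\<forall>e\<ge>5. \<nexists>H. direct_factor H (A\<lparr>carrier := P\<rparr>) \<and>
                   A\<lparr>carrier := H\<rparr> \<cong> integer_mod_group (2 ^ e)))"
proof (intro conjI allI impI notI)
  interpret A: comm_group A by fact
  have n: "n\<^sub>1 \<noteq> 0"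
    using \<open>odd n\<^sub>1\<close> by (rule contrapos_nn) simp
  show "squarefree n\<^sub>1"
    unfolding squarefree_factorial_semiring[OF n]
  proof (intro allI impI notI)
    fix p :: nat assume p: "Factorial_Ring.prime p" "p\<^sup>2 dvd n\<^sub>1"
    then have "odd p"
      using \<open>odd n\<^sub>1\<close> by (metis dvd_trans dvd_power zero_less_numeral)
    then show False
      using A.prime_square_not_dvd_order[OF assms(2) p(1) _ assms(6)] p(2) assms(4) by simp
  qed
  fix P e
  assume P: "sylow_subgroup 2 A P" and e: "5 \<le> e"
    and "\<exists>H. direct_factor H (A\<lparr>carrier := P\<rparr>) \<and> A\<lparr>carrier := H\<rparr> \<cong> integer_mod_group (2 ^ e)"
  then obtain H K where H: "H \<lhd> A\<lparr>carrier := P\<rparr>" and K: "K \<lhd> A\<lparr>carrier := P\<rparr>"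
    and HK: "H \<inter> K = {\<one>\<^bsub>A\<^esub>}" "H <#>\<^bsub>A\<lparr>carrier := P\<rparr>\<^esub> K = P"
    and iso: "A\<lparr>carrier := H\<rparr> \<cong> integer_mod_group (2 ^ e)"
    by (auto simp: direct_factor_def)
  have sub: "subgroup P A"
    using P by (simp add: sylow_subgroup_def)
  interpret P: normal P A
    using sub by (rule A.subgroup_imp_normal)
  \<comment> \<open>As \<open>n\<^sub>1\<close> is odd, \<open>f\<close> is the exact exponent of 2
    in the order, so \<open>P\<close> has index \<open>n\<^sub>1\<close>.\<close>
  have "multiplicity 2 (order A) = f"
    using \<open>odd n\<^sub>1\<close> n by (simp add: assms(4) prime_elem_multiplicity_mult_distrib
        not_dvd_imp_multiplicity_0)
  then have "card (rcosets\<^bsub>A\<^esub> P) = n\<^sub>1"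
    using A.lagrange[OF sub] P assms(4) by (simp add: sylow_subgroup_def)
  then have "order (A Mod P) = n\<^sub>1"
    by (simp add: order_def FactGroup_def)
  \<comment> \<open>The quotient by \<open>P\<close> has order \<open>n\<^sub>1\<close>, so its
    elements are killed by the exponent \<open>n\<^sub>1\<close>.\<close>
  then have "a [^]\<^bsub>A\<^esub> n\<^sub>1 \<in> P" if "a \<in> carrier A" for a
  proof -
    interpret Q: group "A Mod P" by (rule P.factorgroup_is_group)
    have "P #>\<^bsub>A\<^esub> a \<in> carrier (A Mod P)"
      using that by (simp add: carrier_FactGroup)
    then have "P #>\<^bsub>A\<^esub> (a [^]\<^bsub>A\<^esub> n\<^sub>1) = P"
      using Q.pow_order_eq_1[of "P #>\<^bsub>A\<^esub> a"] P.FactGroup_pow[OF that, of n\<^sub>1]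
        \<open>order (A Mod P) = n\<^sub>1\<close> by simp
    then show ?thesis
      using A.coset_join1[OF _ _ sub] that by simp
  qed
  then have pow: "a [^]\<^bsub>A\<^esub> n\<^sub>1 \<in> H <#>\<^bsub>A\<^esub> K" if "a \<in> carrier A" for a
    using that HK(2) by (simp add: set_mult_def)
  \<comment> \<open>The bound on \<open>e\<close> enters here, splitting off the factor 32.\<close>
  have "2 ^ e = 32 * (2 ^ (e - 5) :: nat)"
    using power_add[of "2 :: nat" 5 "e - 5"] e by simp
  then show False
    using A.no_cyclic_factor_of_order_multiple_of_32[OF _ _ HK(1) _ _ pow \<open>odd n\<^sub>1\<close> assms(6), of "2 ^ (e - 5)"]
      iso A.incl_subgroup[OF sub] H K by (simp add: normal_imp_subgroup)
qed

end
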